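(* Assume the setting and notation of the context. Let $\hat\nu_n$, $n\in\mathbb{N}$, be random measures on the Borel sets of $C[0,1]$ and define $\hat\nu_n^*(E):=\hat\nu_n\{z\in C[0,1]\mid \langle z\rangle_n\in E\}$ for Borel sets $E\subset C[0,1]$. If $\hat\nu_n(E)\to\nu(E)$ in probability as $n\to\infty$ for all Borel sets $E\subset C[0,1]$ such that $\inf\{\|z\|_\infty\mid z\in E\}>0$ and $\nu(\partial E)=0$, then also $\hat\nu_n^*(E)\to\nu(E)$ in probability for all Borel sets $E\subset C[0,1]$ such that $\inf\{\|z\|_\infty\mid z\in E\}>0$ and $\nu(\partial E)=0$.
   Context: Setting. $X^{(i)}=(X^{(i)}_t)_{t\in[0,1]}$, $i\in\mathbb{N}$, are iid random processes with continuous sample paths; $F_t$ is the cdf of $X^{(1)}_t$. There are normalizing functions $a_t(n)>0$, $b_t(n)$ such that $\big(\max_{1\le i\le n}(X^{(i)}_t-b_t(n))/a_t(n)\big)_{t\in[0,1]}$ converges weakly in $C[0,1]$ to a max-stable process $Y$ with margins $P\{Y_t\le y\}=\exp(-(1+\gamma_t y)^{-1/\gamma_t})$, $1+\gamma_t y>0$, for some continuous function $t\mapsto\gamma_t$. Then, with $\xi^{(i)}_t:=1/(1-F_t(X^{(i)}_t))$, the processes $\big(\frac1n\max_{1\le i\le n}\xi^{(i)}_t\big)_{t\in[0,1]}$ converge weakly in $C[0,1]$ to $Z=(Z_t)_{t\in[0,1]}:=\big((1+\gamma_tY_t)^{1/\gamma_t}\big)_{t\in[0,1]}$. Exponent measure.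 $\nu$ is the Borel measure on $C[0,1]$ (the exponent measure of $Z$) determined by $P\{Z\in A\}=\exp(-\nu(A^c))$ for all sets $A=\{f\in C[0,1]\mid f(t)\le x_j\ \forall t\in K_j,\ 1\le j\le m\}$ with $m\in\mathbb{N}$, compact $K_j\subset[0,1]$, $x_j\in(0,\infty)$, provided $\inf\{\|f\|_\infty\mid f\in A^c\}>0$. It is well known (and may be used) that $\nu(E)<\infty$ for Borel sets $E\subset C[0,1]$ with $\inf_{z\in E}\|z\|_\infty>0$, and that for such $E$ with $\nu(\partial E)=0$ one has $\lim_{u\to\infty}uP\{u^{-1}\xi^{(1)}\in E\}=\nu(E)$. Here $\partial E$ is the topological boundary of $E$ in $C[0,1]$ with the sup-norm $\|\cdot\|_\infty$. Grid. For each $n$, points $t_{n,1}<t_{n,2}<\dots<t_{n,j_n}$ in $[0,1]$ are given. With $t_{n,0}:=0$, $t_{n,j_n+1}:=1$, put $\delta_n:=\max_{1\le j\le j_n+1}(t_{n,j}-t_{n,j-1})$; it is assumed that $\delta_n\to0$ as $n\to\infty$. Interpolation. For $z=(z_t)_{t\in[0,1]}$, the function $\langle z\rangle_n=(\langle z\rangle_{n,t})_{t\in[0,1]}$ is: $\langle z\rangle_{n,t}:=z_{t_{n,1}}$ if $t\le t_{n,1}$; $\langle z\rangle_{n,t}:=\frac{t_{n,j}-t}{t_{n,j}-t_{n,j-1}}z_{t_{n,j-1}}+\frac{t-t_{n,j-1}}{t_{n,j}-t_{n,j-1}}z_{t_{n,j}}$ if $t_{n,j-1}<t\le t_{n,j}$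 for some $2\le j\le j_n$; $\langle z\rangle_{n,t}:=z_{t_{n,j_n}}$ if $t>t_{n,j_n}$. *)

theory Defs
  imports "HOL-Probability.Probability"
begin

section \<open>The space of continuous functions on the unit interval\<close>

text \<open>
  The unit interval is made a type, so that the library type of bounded continuous functions
  over it is literally \<open>C[0,1]\<close> with the sup-norm, its topology and its Borel sets.
\<close>

typedef unit_interval = "{0..1::real}"
  morphisms to_real of_real01
  by (rule exI[of _ 0]) simp

setup_lifting type_definition_unit_interval

instantiation unit_interval :: metric_space
begin

lift_definition dist_unit_interval :: "unit_interval \<Rightarrow> unit_interval \<Rightarrow> real"
  is "\<lambda>x y. dist x y" .

definition uniformity_unit_interval :: "(unit_interval \<times> unit_interval) filter"
  where "uniformity_unit_interval = (INF e\<in>{0<..}. principal {(x, y). dist x y < e})"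

definition open_unit_interval :: "unit_interval set \<Rightarrow> bool"
  where "open_unit_interval S = (\<forall>x\<in>S. \<forall>\<^sub>F (x', y) in uniformity. x' = x \<longrightarrow> y \<in> S)"

instance
proof
  fix x y z :: unit_interval
  show "(dist x y = 0) = (x = y)"
    by transfer simp
  show "dist x y \<le> dist x z + dist y z"
    by transfer (rule dist_triangle2)
qed (simp_all add: uniformity_unit_interval_def open_unit_interval_def)

end

lemma dist_to_real: "dist (to_real s) (to_real t) = dist s t"
  by transfer simp

lemma continuous_on_to_real: "continuous_on S to_real"
  unfolding continuous_on_iff dist_to_real by blast

lemma continuous_on_of_real01: "continuous_on {0..1} of_real01"
proof -
  have "dist (of_real01 s) (of_real01 t) = dist s t" if "s \<in> {0..1}" "t \<in> {0..1}" for s t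
    using that by (simp add: dist_to_real[symmetric] of_real01_inverse)
  then show ?thesis
    unfolding continuous_on_iff by metis
qed

lemma compact_UNIV_unit_interval: "compact (UNIV :: unit_interval set)"
proof -
  have "of_real01 ` {0..1} = UNIV"
    by (metis UNIV_eq_I imageI to_real to_real_inverse)
  then show ?thesis
    using compact_continuous_image[OF continuous_on_of_real01] by simp
qed

type_synonym C01 = "unit_interval \<Rightarrow>\<^sub>C real"

lemma continuous_imp_bcontfun:
  fixes f :: "unit_interval \<Rightarrow> real"
  assumes "continuous_on UNIV f"
  shows "f \<in> bcontfun"
  using assms compact_continuous_image[OF assms compact_UNIV_unit_interval]
  by (simp add: bcontfun_def compact_imp_bounded)

text \<open>The infimum is taken in the extended reals, so that the empty set is bounded away from 0.\<close>

definition bounded_away_from_0 :: "C01 set \<Rightarrow> bool"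
  where "bounded_away_from_0 E \<longleftrightarrow> 0 < (INF z\<in>E. ereal (norm z))"


section \<open>Random elements of the function space\<close>

text \<open>
  A process with (almost surely) continuous sample paths, given pointwise by a formula, is
  represented by a random element of \<open>C[0,1]\<close> that almost surely coincides with it at all times.
\<close>

definition C01_version ::
    "'w measure \<Rightarrow> ('w \<Rightarrow> unit_interval \<Rightarrow> real) \<Rightarrow> ('w \<Rightarrow> C01) \<Rightarrow> bool"
  where "C01_version M S V \<longleftrightarrow>
    V \<in> borel_measurable M \<and> (AE \<omega> in M. \<forall>t. V \<omega> t = S \<omega> t)"

definition converges_weakly_C01 ::
    "'w measure \<Rightarrow> (nat \<Rightarrow> 'w \<Rightarrow> unit_interval \<Rightarrow> real) \<Rightarrow> 'v measure \<Rightarrow> ('v \<Rightarrow> C01) \<Rightarrow> bool"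
  where "converges_weakly_C01 M S N Y \<longleftrightarrow>
    Y \<in> borel_measurable N \<and>
    (\<exists>V. (\<forall>n\<ge>1. C01_version M (S n) (V n)) \<and>
      (\<forall>g :: C01 \<Rightarrow> real. continuous_on UNIV g \<and> bounded (range g) \<longrightarrow>
        (\<lambda>n. \<integral>\<omega>. g (V n \<omega>) \<partial>M) \<longlonglongrightarrow> (\<integral>\<omega>. g (Y \<omega>) \<partial>N)))"

definition marginal_cdf :: "'w measure \<Rightarrow> ('w \<Rightarrow> C01) \<Rightarrow> unit_interval \<Rightarrow> real \<Rightarrow> real"
  where "marginal_cdf M V t = cdf (distr M borel (\<lambda>\<omega>. V \<omega> t))"

text \<open>
  The \<open>n\<close> independent copies of \<open>Y\<close> are the coordinates of the \<open>n\<close>-fold product of its law.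
\<close>

definition max_stable :: "'v measure \<Rightarrow> ('v \<Rightarrow> C01) \<Rightarrow> bool"
  where "max_stable N Y \<longleftrightarrow>
    (\<forall>n::nat. n \<ge> 1 \<longrightarrow>
      (\<exists>(\<alpha> :: unit_interval \<Rightarrow> real) (\<beta> :: unit_interval \<Rightarrow> real) V. (\<forall>t. \<alpha> t > 0) \<and>
        C01_version (Pi\<^sub>M {1..n} (\<lambda>_. distr N borel Y))
          (\<lambda>y t. MAX i\<in>{1..n}. (apply_bcontfun (y i) t - \<beta> t) / \<alpha> t) V \<and>
        distr (Pi\<^sub>M {1..n} (\<lambda>_. distr N borel Y)) borel V = distr N borel Y))"

text \<open>For \<open>g = 0\<close> the usual limits as \<open>g \<rightarrow> 0\<close> are meant.\<close>

definition gev_cdf :: "real \<Rightarrow> real \<Rightarrow> real"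
  where "gev_cdf g y =
    (if g = 0 then exp (- exp (- y)) else exp (- ((1 + g * y) powr (- 1 / g))))"

definition gev_to_frechet :: "real \<Rightarrow> real \<Rightarrow> real"
  where "gev_to_frechet g y = (if g = 0 then exp y else (1 + g * y) powr (1 / g))"


section \<open>Exponent measure\<close>

text \<open>
  Finiteness away from 0 is part of the notion; it also makes the real-valued
  \<^const>\<open>measure\<close> in the exponent agree with the actual, possibly infinite, mass.
\<close>

definition exponent_measure :: "'v measure \<Rightarrow> ('v \<Rightarrow> C01) \<Rightarrow> C01 measure \<Rightarrow> bool"
  where "exponent_measure N Z \<nu> \<longleftrightarrow>
    sets \<nu> = sets borel \<and>
    (\<forall>E\<in>sets borel. bounded_away_from_0 E \<longrightarrow> emeasure \<nu> E < \<infinity>) \<and>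
    (\<forall>(m::nat) (K :: nat \<Rightarrow> unit_interval set) (x :: nat \<Rightarrow> real).
      (\<forall>j\<in>{1..m}. compact (K j) \<and> x j > 0) \<longrightarrow>
      (let A = {f :: C01. \<forall>j\<in>{1..m}. \<forall>t\<in>K j. f t \<le> x j} in
        bounded_away_from_0 (- A) \<longrightarrow>
        measure N {\<omega>\<in>space N. Z \<omega> \<in> A} = exp (- measure \<nu> (- A))))"


section \<open>Random measures\<close>

definition random_measure_C01 :: "'w measure \<Rightarrow> ('w \<Rightarrow> C01 measure) \<Rightarrow> bool"
  where "random_measure_C01 M \<mu> \<longleftrightarrow>
    (\<forall>\<omega>\<in>space M. sets (\<mu> \<omega>) = sets borel) \<and>
    (\<forall>E\<in>sets borel. (\<lambda>\<omega>. emeasure (\<mu> \<omega>) E) \<in> borel_measurable M)"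

text \<open>
  Random measures may take the value \<open>\<infinity>\<close>, which has distance \<open>\<infinity>\<close> from any finite limit.
\<close>

definition converges_in_probability :: "'w measure \<Rightarrow> (nat \<Rightarrow> 'w \<Rightarrow> ennreal) \<Rightarrow> ennreal \<Rightarrow> bool"
  where "converges_in_probability M S c \<longleftrightarrow>
    (\<forall>\<epsilon>>0. (\<lambda>n. measure M {\<omega>\<in>space M.
      \<bar>enn2ereal (S n \<omega>) - enn2ereal c\<bar> > ereal \<epsilon>}) \<longlonglongrightarrow> 0)"


section \<open>Grids and interpolation\<close>

text \<open>A grid consists of the points \<open>s 1 < \<dots> < s m\<close>; other values of \<open>s\<close> are irrelevant.\<close>

definition is_grid :: "(nat \<Rightarrow> unit_interval) \<Rightarrow> nat \<Rightarrow> bool"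
  where "is_grid s m \<longleftrightarrow> 1 \<le> m \<and> (\<forall>i j. 1 \<le> i \<and> i < j \<and> j \<le> m \<longrightarrow> to_real (s i) < to_real (s j))"

definition grid_ext :: "(nat \<Rightarrow> unit_interval) \<Rightarrow> nat \<Rightarrow> nat \<Rightarrow> real"
  where "grid_ext s m j = (if j = 0 then 0 else if j = m + 1 then 1 else to_real (s j))"

definition mesh :: "(nat \<Rightarrow> unit_interval) \<Rightarrow> nat \<Rightarrow> real"
  where "mesh s m = (MAX j\<in>{1..m+1}. grid_ext s m j - grid_ext s m (j - 1))"

definition interpolate ::
    "(nat \<Rightarrow> unit_interval) \<Rightarrow> nat \<Rightarrow> (unit_interval \<Rightarrow> real) \<Rightarrow> unit_interval \<Rightarrow> real"
  where "interpolate s m z t =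
    (if to_real t \<le> to_real (s 1) then z (s 1)
     else if to_real t > to_real (s m) then z (s m)
     else let j = (THE j. 2 \<le> j \<and> j \<le> m \<and> to_real (s (j - 1)) < to_real t \<and> to_real t \<le> to_real (s j))
       in (to_real (s j) - to_real t) / (to_real (s j) - to_real (s (j - 1))) * z (s (j - 1))
        + (to_real t - to_real (s (j - 1))) / (to_real (s j) - to_real (s (j - 1))) * z (s j))"

text \<open>By the lemma below, the following is not affected by the totalisation of \<^const>\<open>Bcontfun\<close>.\<close>

definition interpolate_C01 :: "(nat \<Rightarrow> unit_interval) \<Rightarrow> nat \<Rightarrow> C01 \<Rightarrow> C01"
  where "interpolate_C01 s m z = Bcontfun (interpolate s m (apply_bcontfun z))"

lemma interpolate_middle:
  assumes g: "is_grid s m" and i: "2 \<le> i" "i \<le> m"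
    and t: "to_real (s (i - 1)) < to_real t" "to_real t \<le> to_real (s i)"
  shows "interpolate s m z t =
    (to_real (s i) - to_real t) / (to_real (s i) - to_real (s (i - 1))) * z (s (i - 1))
        + (to_real t - to_real (s (i - 1))) / (to_real (s i) - to_real (s (i - 1))) * z (s i)"
proof -
  have mono: "to_real (s a) \<le> to_real (s b)" if "1 \<le> a" "a \<le> b" "b \<le> m" for a b
    using g that unfolding is_grid_def by (metis le_neq_implies_less less_eq_real_def)
  have "(THE j. 2 \<le> j \<and> j \<le> m \<and> to_real (s (j - 1)) < to_real t \<and> to_real t \<le> to_real (s j)) = i"
  proof (rule the_equality)
    fix j assume j: "2 \<le> j \<and> j \<le> m \<and> to_real (s (j - 1)) < to_real t \<and> to_real t \<le> to_real (s j)"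
    show "j = i"
    proof (rule ccontr)
      assume "j \<noteq> i"
      then consider "j \<le> i - 1" | "i \<le> j - 1" by linarith
      then show False
      proof cases
        case 1
        then have "to_real (s j) \<le> to_real (s (i - 1))" using j i by (intro mono) auto
        then show False using j t by linarith
      next
        case 2
        then have "to_real (s i) \<le> to_real (s (j - 1))" using j i by (intro mono) auto
        then show False using j t by linarith
      qed
    qed
  qed (use i t in auto)
  moreover have "to_real (s 1) < to_real t" "to_real t \<le> to_real (s m)"
    using t i mono[of 1 "i - 1"] mono[of i m] by (simp_all, linarith+)
  ultimately show ?thesis
    by (simp add: interpolate_def Let_def)
qed

lemma interpolate_bcontfun:
  assumes g: "is_grid s m"
  shows "interpolate s m z \<in> bcontfun"
proof -
  define c where "c j t = (z (s j) - z (s (j - 1))) / (to_real (s j) - to_real (s (j - 1))) *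
    (max (to_real (s (j - 1))) (min (to_real t) (to_real (s j))) - to_real (s (j - 1)))" for j t
  have mono: "to_real (s a) \<le> to_real (s b)" if "1 \<le> a" "a \<le> b" "b \<le> m" for a b
    using g that unfolding is_grid_def by (metis le_neq_implies_less less_eq_real_def)
  have smono: "to_real (s (j - 1)) < to_real (s j)" if "2 \<le> j" "j \<le> m" for j
    using g that unfolding is_grid_def by auto
  have low: "c j t = 0" if "2 \<le> j" "j \<le> m" "to_real t \<le> to_real (s (j - 1))" for j t
    using that smono[of j] by (simp add: c_def)
  have full: "(\<Sum>j=2..k. c j t) = z (s k) - z (s 1)"
    if "1 \<le> k" "k \<le> m" "to_real (s k) \<le> to_real t" for k t
    using that
  proof (induction k rule: dec_induct)
    case (step k)
    have "to_real (s k) < to_real (s (Suc k))" using smono[of "Suc k"] step by simp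
    then have "c (Suc k) t = z (s (Suc k)) - z (s k)"
      using step.prems by (simp add: c_def)
    moreover have "(\<Sum>j=2..k. c j t) = z (s k) - z (s 1)"
      using step \<open>to_real (s k) < to_real (s (Suc k))\<close> by simp
    ultimately show ?case using step by (simp add: sum.cl_ivl_Suc)
  qed simp
  have "interpolate s m z t = z (s 1) + (\<Sum>j=2..m. c j t)" for t
  proof -
    have m: "1 \<le> m" using g by (simp add: is_grid_def)
    consider "to_real t \<le> to_real (s 1)" | "to_real t > to_real (s m)" "to_real t > to_real (s 1)"
      | "to_real (s 1) < to_real t" "to_real t \<le> to_real (s m)" by linarith
    then show ?thesis
    proof cases
      case 1
      have "c j t = 0" if "j \<in> {2..m}" for j
      proof (rule low)
        have "to_real (s 1) \<le> to_real (s (j - 1))" using that by (intro mono) auto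
        then show "to_real t \<le> to_real (s (j - 1))" using 1 by linarith
      qed (use that in auto)
      then show ?thesis using 1 by (simp add: interpolate_def)
    next
      case 2
      then show ?thesis using full[of m t] m by (simp add: interpolate_def)
    next
      case 3
      define i where "i = (LEAST i. 1 \<le> i \<and> to_real t \<le> to_real (s i))"
      have i: "1 \<le> i" "to_real t \<le> to_real (s i)"
        unfolding i_def using LeastI[of "\<lambda>i. 1 \<le> i \<and> to_real t \<le> to_real (s i)" m] m 3 by auto
      have im: "i \<le> m" unfolding i_def using m 3 by (intro Least_le) auto
      have i2: "2 \<le> i" using i 3 by (metis One_nat_def Suc_1 Suc_leI le_neq_implies_less not_le)
      have ti: "to_real (s (i - 1)) < to_real t"
        using not_less_Least[of "i - 1" "\<lambda>i. 1 \<le> i \<and> to_real t \<le> to_real (s i)"] i2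
        unfolding i_def[symmetric] by auto
      have "c j t = 0" if "j \<in> {2..m} - {2..i}" for j
      proof (rule low)
        have "to_real (s i) \<le> to_real (s (j - 1))" using that i(1) by (intro mono) auto
        then show "to_real t \<le> to_real (s (j - 1))" using i(2) by linarith
      qed (use that in auto)
      then have "(\<Sum>j=2..m. c j t) = (\<Sum>j\<in>{2..i}. c j t)"
        using im by (intro sum.mono_neutral_right) auto
      also have "{2..i} = insert i {2..i - 1}" using i2 by auto
      also have "(\<Sum>j\<in>insert i {2..i - 1}. c j t) = c i t + (\<Sum>j=2..i - 1. c j t)"
        using i2 by (subst sum.insert) auto
      also have "(\<Sum>j=2..i - 1. c j t) = z (s (i - 1)) - z (s 1)"
        using i2 im ti by (intro full) auto
      finally have "z (s 1) + (\<Sum>j=2..m. c j t) = c i t + z (s (i - 1))" by simp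
      also have "\<dots> = interpolate s m z t"
        using interpolate_middle[OF g i2 im ti i(2), of z] smono[OF i2 im] ti i(2)
        by (simp add: c_def divide_simps) (simp add: algebra_simps)
      finally show ?thesis by simp
    qed
  qed
  then have "interpolate s m z = (\<lambda>t. z (s 1) + (\<Sum>j=2..m. c j t))" by auto
  moreover have "continuous_on UNIV \<dots>"
    unfolding c_def by (intro continuous_intros continuous_on_to_real)
  ultimately show ?thesis by (simp add: continuous_imp_bcontfun)
qed

lemma apply_interpolate_C01:
  "is_grid s m \<Longrightarrow> apply_bcontfun (interpolate_C01 s m z) = interpolate s m (apply_bcontfun z)"
  by (simp add: interpolate_C01_def Bcontfun_inverse interpolate_bcontfun)

end

(* Interpolation is nonexpansive and converges pointwise to the identity, because every path is
   uniformly continuous.  Hence the closed sets closure (UN n>=k. {z. <z>_n : E}) decrease into the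
   closure of E, and the open sets interior (INT n>=k. {z. <z>_n : E}) increase to a set containing
   the interior of E.  Since nu is finite away from 0 and does not charge the frontier of E, both
   have measure close to nu E for large k.  Enlarging the former and shrinking the latter slightly,
   by distances whose level sets are nu-null (all but countably many), gives nu-continuity sets that
   do not depend on n and between which {z. <z>_n : E} is eventually trapped. *)

theory Submission
  imports Defs
begin

section \<open>Continuity sets\<close>

text \<open>The image under \<open>f\<close> of \<open>\<mu>\<close> restricted to \<open>D\<close>
  is a finite measure on the reals, so it has at most countably many atoms, while the interval from
  \<open>a\<close> to \<open>b\<close> is uncountable. Since every level set between
  \<open>a\<close> and \<open>b\<close> lies in \<open>D\<close>, the restriction loses none of its
  mass.\<close>

lemma exists_null_level_set:
  fixes f :: "'a::metric_space \<Rightarrow> real"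
  assumes sets: "sets \<mu> = sets borel" and f: "continuous_on UNIV f"
    and D: "D \<in> sets \<mu>" "emeasure \<mu> D < \<infinity>" and sub: "\<And>z. a < f z \<Longrightarrow> f z < b \<Longrightarrow> z \<in> D"
    and "a < b"
  obtains r where "a < r" "r < b" "emeasure \<mu> {z. f z = r} = 0"
proof -
  have fb: "f \<in> borel_measurable borel"
    by (rule borel_measurable_continuous_onI[OF f])
  have space: "space \<mu> = UNIV"
    using sets_eq_imp_space_eq[OF sets] by simp
  have fm: "f \<in> borel_measurable (restrict_space \<mu> D)"
    using fb sets by (intro measurable_restrict_space1) (simp cong: measurable_cong_sets)
  define \<rho> where "\<rho> = distr (restrict_space \<mu> D) borel f"
  have "emeasure \<rho> (space \<rho>) = emeasure \<mu> D"
    using D space fm unfolding \<rho>_def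
    by (simp add: emeasure_distr space_restrict_space emeasure_restrict_space)
  then interpret \<rho>: finite_measure \<rho>
    using D by (intro finite_measureI) auto
  have "uncountable ({a<..<b} - {x. measure \<rho> {x} \<noteq> 0})"
    by (intro uncountable_minus_countable \<rho>.countable_support)
       (use \<open>a < b\<close> in \<open>simp add: uncountable_open_interval\<close>)
  then have "{a<..<b} - {x. measure \<rho> {x} \<noteq> 0} \<noteq> {}"
    by (metis countable_empty)
  then obtain r where r: "a < r" "r < b" "measure \<rho> {r} = 0"
    by auto
  have "{z. f z = r} \<subseteq> D"
    using sub r by auto
  then have "f -` {r} \<inter> space (restrict_space \<mu> D) = {z. f z = r}"
    using space by (auto simp: space_restrict_space)
  then have "emeasure \<rho> {r} = emeasure \<mu> {z. f z = r}"
    using \<open>{z. f z = r} \<subseteq> D\<close> fm D space unfolding \<rho>_def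
    by (simp add: emeasure_distr emeasure_restrict_space)
  with r show thesis
    using that \<rho>.emeasure_eq_measure by auto
qed

lemma frontier_sublevel_subset:
  fixes f :: "'a::topological_space \<Rightarrow> real"
  assumes "continuous_on UNIV f"
  shows "frontier {z. f z \<le> r} \<subseteq> {z. f z = r}"
proof -
  have "open {z. f z < r}" "closed {z. f z \<le> r}"
    using assms by (auto intro: open_Collect_less closed_Collect_le continuous_on_const)
  then have "{z. f z < r} \<subseteq> interior {z. f z \<le> r}"
    by (intro interior_maximal) auto
  then show ?thesis
    using \<open>closed {z. f z \<le> r}\<close> by (force simp: frontier_def)
qed

text \<open>Continuity from above along the sets \<open>f z \<le> R / Suc n\<close>, which decrease
  to \<open>f z \<le> 0\<close>. The intended \<open>f\<close> is the distance to a closed set,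
  whose zero set is the closed set itself.\<close>

lemma exists_outer_continuity_level:
  fixes f :: "'a::metric_space \<Rightarrow> real"
  assumes sets: "sets \<mu> = sets borel" and f: "continuous_on UNIV f"
    and fin: "emeasure \<mu> {z. f z \<le> R} < \<infinity>" and R: "R > 0" and e: "\<epsilon> > 0"
  obtains r where "0 < r" "r < R" "emeasure \<mu> (frontier {z. f z \<le> r}) = 0"
    "measure \<mu> {z. f z \<le> r} < measure \<mu> {z. f z \<le> 0} + \<epsilon>"
proof -
  have cl: "closed {z. f z \<le> r}" for r
    by (intro closed_Collect_le f continuous_on_const)
  have meas: "{z. f z \<le> r} \<in> sets \<mu>" for r
    using cl sets by auto
  have lim: "(\<lambda>n. measure \<mu> {z. f z \<le> R / real (Suc n)}) \<longlonglongrightarrow> measure \<mu> (\<Inter>n. {z. f z \<le> R / real (Suc n)})"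
  proof (rule Lim_measure_decseq)
    show "range (\<lambda>n. {z. f z \<le> R / real (Suc n)}) \<subseteq> sets \<mu>"
      using meas by auto
    show "decseq (\<lambda>n. {z. f z \<le> R / real (Suc n)})"
    proof (intro decseq_SucI subsetI)
      fix n z assume z: "z \<in> {z. f z \<le> R / real (Suc (Suc n))}"
      have "R / real (Suc (Suc n)) \<le> R / real (Suc n)"
        using R by (intro divide_left_mono) auto
      with z show "z \<in> {z. f z \<le> R / real (Suc n)}" by auto
    qed
    show "emeasure \<mu> {z. f z \<le> R / real (Suc n)} \<noteq> \<infinity>" for n
    proof -
      have "R / real (Suc n) \<le> R / 1"
        using R by (intro divide_left_mono) auto
      then have "{z. f z \<le> R / real (Suc n)} \<subseteq> {z. f z \<le> R}"
        by auto
      from emeasure_mono[OF this meas] show ?thesis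
        using fin by auto
    qed
  qed
  have "(\<Inter>n. {z. f z \<le> R / real (Suc n)}) = {z. f z \<le> 0}"
  proof (intro equalityI subsetI)
    fix z assume z: "z \<in> (\<Inter>n. {z. f z \<le> R / real (Suc n)})"
    have "(\<lambda>n. R / real (Suc n)) \<longlonglongrightarrow> 0"
      by (rule LIMSEQ_Suc[OF lim_const_over_n])
    then have "f z \<le> 0"
      by (rule LIMSEQ_le_const) (use z in auto)
    then show "z \<in> {z. f z \<le> 0}" by simp
  next
    fix z assume "z \<in> {z. f z \<le> 0}"
    then show "z \<in> (\<Inter>n. {z. f z \<le> R / real (Suc n)})"
      using R by (auto intro: order_trans[of _ 0])
  qed
  with lim have "\<forall>\<^sub>F n in sequentially. measure \<mu> {z. f z \<le> R / real (Suc n)} < measure \<mu> {z. f z \<le> 0} + \<epsilon>"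
    using e by (intro order_tendstoD) auto
  then obtain n where n: "measure \<mu> {z. f z \<le> R / real (Suc n)} < measure \<mu> {z. f z \<le> 0} + \<epsilon>"
    by (meson eventually_happens sequentially_bot)
  have Rn: "R / real (Suc n) \<le> R / 1"
    using R by (intro divide_left_mono) auto
  \<comment> \<open>The level \<open>R / Suc n\<close> itself may carry mass, so a null level
    strictly below it is taken. The mass bound survives because sublevel sets shrink with the
    level.\<close>
  obtain r where r: "0 < r" "r < R / real (Suc n)" "emeasure \<mu> {z. f z = r} = 0"
    by (rule exists_null_level_set[OF sets f meas fin, of 0 "R / real (Suc n)"])
       (use R Rn in auto)
  have "{z. f z = r} \<in> sets \<mu>"
    using closed_Collect_eq[OF f continuous_on_const[of UNIV r]] sets by auto
  from emeasure_mono[OF frontier_sublevel_subset[OF f] this]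
  have "emeasure \<mu> (frontier {z. f z \<le> r}) = 0"
    using r by simp
  moreover
  have "{z. f z \<le> R / real (Suc n)} \<in> fmeasurable \<mu>"
    using emeasure_mono[of "{z. f z \<le> R / real (Suc n)}" "{z. f z \<le> R}" \<mu>] fin meas Rn
    by (auto intro!: fmeasurableI intro: le_less_trans simp: subset_iff)
  then have "measure \<mu> {z. f z \<le> r} \<le> measure \<mu> {z. f z \<le> R / real (Suc n)}"
    using r meas by (intro measure_mono_fmeasurable) auto
  ultimately show thesis
    using that[of r] r n Rn by simp
qed

text \<open>The counterpart from inside: continuity from below along
  \<open>inverse (Suc n) \<le> f z\<close>, whose union is \<open>0 < f z\<close>. The intended
  \<open>f\<close> is the distance to the complement of an open set.\<close>

lemma exists_inner_continuity_level:
  fixes f :: "'a::metric_space \<Rightarrow> real"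
  assumes sets: "sets \<mu> = sets borel" and f: "continuous_on UNIV f"
    and fin: "emeasure \<mu> {z. 0 < f z} < \<infinity>" and e: "\<epsilon> > 0"
  obtains r where "0 < r" "emeasure \<mu> (frontier {z. r \<le> f z}) = 0"
    "measure \<mu> {z. 0 < f z} < measure \<mu> {z. r \<le> f z} + \<epsilon>"
proof -
  have meas: "{z. r \<le> f z} \<in> sets \<mu>" for r
    using sets closed_Collect_le[OF continuous_on_const f] by auto
  have meas0: "{z. 0 < f z} \<in> sets \<mu>"
    using sets open_Collect_less[OF continuous_on_const f] by auto
  have Un: "(\<Union>n. {z. inverse (real (Suc n)) \<le> f z}) = {z. 0 < f z}"
  proof (intro equalityI subsetI)
    fix z assume "z \<in> {z. 0 < f z}"
    then obtain n where "inverse (real (Suc n)) < f z"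
      using reals_Archimedean[of "f z"] by auto
    then show "z \<in> (\<Union>n. {z. inverse (real (Suc n)) \<le> f z})"
      by (auto intro!: exI[of _ n])
  next
    fix z assume "z \<in> (\<Union>n. {z. inverse (real (Suc n)) \<le> f z})"
    then obtain n where "inverse (real (Suc n)) \<le> f z" by auto
    moreover have "0 < inverse (real (Suc n))" by simp
    ultimately show "z \<in> {z. 0 < f z}" by (simp only: mem_Collect_eq)
  qed
  have "(\<lambda>n. measure \<mu> {z. inverse (real (Suc n)) \<le> f z}) \<longlonglongrightarrow> measure \<mu> (\<Union>n. {z. inverse (real (Suc n)) \<le> f z})"
  proof (rule Lim_measure_incseq)
    show "range (\<lambda>n. {z. inverse (real (Suc n)) \<le> f z}) \<subseteq> sets \<mu>"
      using meas by auto
    show "incseq (\<lambda>n. {z. inverse (real (Suc n)) \<le> f z})"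
    proof (intro incseq_SucI subsetI)
      fix n z assume z: "z \<in> {z. inverse (real (Suc n)) \<le> f z}"
      have "inverse (real (Suc (Suc n))) \<le> inverse (real (Suc n))"
        by (intro le_imp_inverse_le) auto
      from order_trans[OF this] z show "z \<in> {z. inverse (real (Suc (Suc n))) \<le> f z}" by blast
    qed
    show "emeasure \<mu> (\<Union>n. {z. inverse (real (Suc n)) \<le> f z}) \<noteq> \<infinity>"
      using fin unfolding Un by auto
  qed
  then have "\<forall>\<^sub>F n in sequentially. measure \<mu> {z. 0 < f z} - \<epsilon> < measure \<mu> {z. inverse (real (Suc n)) \<le> f z}"
    using e unfolding Un by (intro order_tendstoD) auto
  then obtain n where n: "measure \<mu> {z. 0 < f z} - \<epsilon> < measure \<mu> {z. inverse (real (Suc n)) \<le> f z}"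
    by (meson eventually_happens sequentially_bot)
  obtain r where r: "0 < r" "r < inverse (real (Suc n))" "emeasure \<mu> {z. f z = r} = 0"
    by (rule exists_null_level_set[OF sets f meas0 fin, of 0 "inverse (real (Suc n))"]) auto
  have eq: "{z. f z = r} \<in> sets \<mu>"
    using closed_Collect_eq[OF f continuous_on_const[of UNIV r]] sets by auto
  \<comment> \<open>A superlevel set of \<open>f\<close> is a sublevel set of \<open>- f\<close>, so
    the frontier bound for sublevel sets applies.\<close>
  have "frontier {z. - f z \<le> - r} \<subseteq> {z. - f z = - r}"
    by (intro frontier_sublevel_subset continuous_on_minus f)
  then have "emeasure \<mu> (frontier {z. r \<le> f z}) = 0"
    using emeasure_mono[of "frontier {z. r \<le> f z}" _ \<mu>, OF _ eq] r by simp
  moreover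
  have "{z. r \<le> f z} \<in> fmeasurable \<mu>"
    using emeasure_mono[of "{z. r \<le> f z}" "{z. 0 < f z}" \<mu>] fin meas meas0 r
    by (auto intro!: fmeasurableI intro: le_less_trans simp: subset_iff)
  then have "measure \<mu> {z. inverse (real (Suc n)) \<le> f z} \<le> measure \<mu> {z. r \<le> f z}"
    using r meas by (intro measure_mono_fmeasurable) auto
  ultimately show thesis
    using that[of r] r n by simp
qed

lemma continuity_set_measure:
  assumes sets: "sets \<mu> = sets borel" and null: "emeasure \<mu> (frontier E) = 0"
  shows "emeasure \<mu> (closure E) = emeasure \<mu> (interior E)"
proof -
  have "closure E = interior E \<union> frontier E"
    using order_trans[OF interior_subset closure_subset, of E] by (auto simp: frontier_def)
  moreover have "frontier E \<in> null_sets \<mu>"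
    using null sets by (auto simp: null_sets_def)
  ultimately show ?thesis
    using sets by (simp add: emeasure_Un_null_set)
qed


section \<open>Preimages under nonexpansive maps converging to the identity\<close>

context
  fixes T :: "nat \<Rightarrow> 'a::metric_space \<Rightarrow> 'a"
  assumes nonexp: "\<And>n x y. dist (T n x) (T n y) \<le> dist x y"
    and T_lim: "\<And>z. (\<lambda>n. T n z) \<longlonglongrightarrow> z"
begin

text \<open>A point \<open>z\<close> of the intersection has, beyond any index, some
  \<open>n\<close> and a nearby \<open>y\<close> with \<open>T n y\<close> in \<open>E\<close>.
  Nonexpansiveness moves \<open>T n y\<close> close to \<open>T n z\<close>, and this is close to
  \<open>z\<close>. Pointwise convergence is invoked only at \<open>z\<close>, so \<open>y\<close>
  may vary with \<open>n\<close>.\<close>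

lemma Inter_closure_vimage_subset:
  "(\<Inter>k. closure (\<Union>n\<in>{k..}. T n -` E)) \<subseteq> closure E"
proof
  fix z assume z: "z \<in> (\<Inter>k. closure (\<Union>n\<in>{k..}. T n -` E))"
  show "z \<in> closure E"
    unfolding closure_approachable
  proof (intro allI impI)
    fix e :: real assume "e > 0"
    then obtain k where k: "\<And>n. n \<ge> k \<Longrightarrow> dist (T n z) z < e / 2"
      using tendstoD[OF T_lim, of "e / 2" z] by (auto simp: eventually_sequentially)
    have "z \<in> closure (\<Union>n\<in>{k..}. T n -` E)" using z by auto
    then obtain y where "y \<in> (\<Union>n\<in>{k..}. T n -` E)" "dist y z < e / 2"
      using \<open>e > 0\<close> unfolding closure_approachable by (meson half_gt_zero)
    then obtain n where n: "n \<ge> k" "T n y \<in> E" by auto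
    have "dist (T n y) z \<le> dist (T n y) (T n z) + dist (T n z) z"
      by (rule dist_triangle)
    also have "\<dots> < e"
      using nonexp[of n y z] k[OF n(1)] \<open>dist y z < e / 2\<close> by linarith
    finally show "\<exists>y\<in>E. dist y z < e" using n by auto
  qed
qed

text \<open>If the ball of radius \<open>e\<close> about \<open>z\<close> lies in \<open>E\<close>,
  then once \<open>T n z\<close> is within \<open>e / 2\<close> of \<open>z\<close>,
  \<open>T n\<close> maps the ball of radius \<open>e / 2\<close> into the larger one. A single
  \<open>k\<close> therefore serves the whole small ball.\<close>

lemma interior_subset_Union_interior_vimage:
  "interior E \<subseteq> (\<Union>k. interior (\<Inter>n\<in>{k..}. T n -` E))"
proof
  fix z assume "z \<in> interior E"
  then obtain e where e: "e > 0" "ball z e \<subseteq> E"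
    by (auto simp: mem_interior)
  then obtain k where k: "\<And>n. n \<ge> k \<Longrightarrow> dist (T n z) z < e / 2"
    using tendstoD[OF T_lim, of "e / 2" z] by (auto simp: eventually_sequentially)
  have "ball z (e / 2) \<subseteq> (\<Inter>n\<in>{k..}. T n -` E)"
  proof clarsimp
    fix y n assume "dist z y * 2 < e" "k \<le> n"
    then have "dist z (T n y) < e"
      using dist_triangle[of z "T n y" "T n z"] nonexp[of n z y] k[of n] by (simp add: dist_commute)
    then show "T n y \<in> E" using e by auto
  qed
  then have "z \<in> interior (\<Inter>n\<in>{k..}. T n -` E)"
    using e by (auto simp: mem_interior intro!: exI[of _ "e / 2"])
  then show "z \<in> (\<Union>k. interior (\<Inter>n\<in>{k..}. T n -` E))" by auto
qed

end

text \<open>Keeps neighbourhoods of a set bounded away from 0. Nonemptiness matters because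
  \<open>infdist z {}\<close> is 0 by convention.\<close>

lemma norm_ge_of_infdist_le:
  fixes U :: "'a::real_normed_vector set"
  assumes "U \<noteq> {}" "\<And>u. u \<in> U \<Longrightarrow> c \<le> norm u" "infdist z U \<le> r"
  shows "c - r \<le> norm z"
proof -
  have "c - norm z \<le> dist z u" if "u \<in> U" for u
    using assms(2)[OF that] norm_triangle_ineq2[of u z] by (simp add: dist_norm norm_minus_commute)
  then have "c - norm z \<le> infdist z U"
    using assms(1) by (auto simp: infdist_def intro!: cINF_greatest)
  with assms(3) show ?thesis by linarith
qed

section \<open>Continuity sets that trap the preimages of a fixed continuity set\<close>

context
  fixes T :: "nat \<Rightarrow> 'a::real_normed_vector \<Rightarrow> 'a" and \<mu> :: "'a measure" and E :: "'a set"
    and c :: real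
  assumes nonexp: "\<And>n x y. dist (T n x) (T n y) \<le> dist x y"
    and T_lim: "\<And>z. (\<lambda>n. T n z) \<longlonglongrightarrow> z"
    and T_0: "\<And>n. T n 0 = 0"
    and sets: "sets \<mu> = sets borel"
    and fin: "\<And>c. c > 0 \<Longrightarrow> emeasure \<mu> {z. c \<le> norm z} < \<infinity>"
    and E: "E \<in> sets borel" and null: "emeasure \<mu> (frontier E) = 0"
    and c: "c > 0" "\<And>z. z \<in> E \<Longrightarrow> c \<le> norm z"
begin

text \<open>A nonexpansive map fixing 0 cannot increase the norm, so all preimages of
  \<open>E\<close> inherit its lower bound \<open>c\<close>, uniformly in \<open>n\<close>.\<close>

lemma T_vimage_norm_ge: "T n z \<in> E \<Longrightarrow> c \<le> norm z"
  using c(2)[of "T n z"] nonexp[of n z 0] T_0 by simp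

lemma finite_away:
  assumes "d > 0" "\<And>z. z \<in> A \<Longrightarrow> d \<le> norm z"
  shows "emeasure \<mu> A < \<infinity>"
proof -
  have "closed {z::'a. d \<le> norm z}"
    by (intro closed_Collect_le continuous_intros)
  then have "emeasure \<mu> A \<le> emeasure \<mu> {z. d \<le> norm z}"
    using assms sets by (intro emeasure_mono) auto
  with fin[OF assms(1)] show ?thesis by simp
qed

lemma measure_closure_interior_eq:
  "measure \<mu> (closure E) = measure \<mu> E" "measure \<mu> (interior E) = measure \<mu> E"
proof -
  have "emeasure \<mu> (interior E) \<le> emeasure \<mu> E" "emeasure \<mu> E \<le> emeasure \<mu> (closure E)"
    using sets E emeasure_mono[OF interior_subset, of E \<mu>] emeasure_mono[OF closure_subset, of E \<mu>]
    by simp_all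
  with continuity_set_measure[OF sets null]
  show "measure \<mu> (closure E) = measure \<mu> E" "measure \<mu> (interior E) = measure \<mu> E"
    by (auto simp: measure_def)
qed

text \<open>One half of \<open>\<epsilon>\<close> pays for passing from \<open>E\<close> to a closed
  set \<open>U k\<close>, the other for passing from \<open>U k\<close> to a closed neighbourhood.
  The second step is there because the frontier of \<open>U k\<close> may have positive
  mass.\<close>

lemma exists_outer_continuity_set:
  assumes e: "\<epsilon> > 0"
  obtains V d where "V \<in> sets borel" "d > 0" "\<And>z. z \<in> V \<Longrightarrow> d \<le> norm z"
    "emeasure \<mu> (frontier V) = 0" "\<forall>\<^sub>F n in sequentially. T n -` E \<subseteq> V"
    "measure \<mu> V \<le> measure \<mu> E + \<epsilon>"
proof -
  define U where "U k = closure (\<Union>n\<in>{k..}. T n -` E)" for k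
  have "closed {z::'a. c \<le> norm z}"
    by (intro closed_Collect_le continuous_intros)
  then have "U k \<subseteq> {z. c \<le> norm z}" for k
    unfolding U_def by (intro closure_minimal) (auto dest: T_vimage_norm_ge)
  then have U: "c \<le> norm z" if "z \<in> U k" for k z
    using that by auto
  have U_sets: "U k \<in> sets \<mu>" for k
    unfolding sets U_def by (rule borel_closed[OF closed_closure])
  have "(\<lambda>k. measure \<mu> (U k)) \<longlonglongrightarrow> measure \<mu> (\<Inter>k. U k)"
  proof (rule Lim_measure_decseq)
    show "range U \<subseteq> sets \<mu>" using U_sets by blast
    show "decseq U" unfolding U_def by (intro decseq_SucI closure_mono UN_mono) auto
    show "emeasure \<mu> (U k) \<noteq> \<infinity>" for k
      using finite_away[OF c(1), of "U k"] U by auto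
  qed
  moreover have "measure \<mu> (\<Inter>k. U k) \<le> measure \<mu> (closure E)"
  proof (rule measure_mono_fmeasurable)
    show "(\<Inter>k. U k) \<subseteq> closure E"
      unfolding U_def by (rule Inter_closure_vimage_subset[OF nonexp T_lim])
    show "(\<Inter>k. U k) \<in> sets \<mu>" using U_sets by (intro sets.countable_INT') auto
    have "E \<subseteq> {z. c \<le> norm z}" using c(2) by auto
    then have "closure E \<subseteq> {z. c \<le> norm z}"
      by (intro closure_minimal \<open>closed _\<close>)
    then show "closure E \<in> fmeasurable \<mu>"
      using finite_away[OF c(1), of "closure E"] sets by (intro fmeasurableI) auto
  qed
  ultimately have "\<forall>\<^sub>F k in sequentially. measure \<mu> (U k) < measure \<mu> E + \<epsilon> / 2"
    using e by (intro order_tendstoD(2)) (auto simp: measure_closure_interior_eq)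
  then obtain k where k: "measure \<mu> (U k) < measure \<mu> E + \<epsilon> / 2"
    by (meson eventually_happens sequentially_bot)
  have ev: "\<forall>\<^sub>F n in sequentially. T n -` E \<subseteq> U k"
    using eventually_ge_at_top[of k]
    by eventually_elim (auto simp: U_def intro!: subsetD[OF closure_subset])
  show thesis
  \<comment> \<open>With the convention \<open>infdist z {} = 0\<close> the sublevel sets would be
    the whole space, so an empty \<open>U k\<close> is treated apart.\<close>
  proof (cases "U k = {}")
    case True
    show ?thesis
      by (rule that[of "{}" 1]) (use True ev e in auto)
  next
    case False
    \<comment> \<open>Radii up to \<open>c / 2\<close> use up at most half of the distance to 0.
      This gives finite mass for the largest neighbourhood and the bound \<open>d = c / 2\<close>
      for \<open>V\<close>.\<close>
    have near: "c / 2 \<le> norm z" if "infdist z (U k) \<le> c / 2" for z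
      using norm_ge_of_infdist_le[OF False U that] by simp
    have cont: "continuous_on UNIV (\<lambda>z. infdist z (U k))"
      by (intro continuous_intros)
    obtain r where r: "0 < r" "r < c / 2" "emeasure \<mu> (frontier {z. infdist z (U k) \<le> r}) = 0"
      "measure \<mu> {z. infdist z (U k) \<le> r} < measure \<mu> {z. infdist z (U k) \<le> 0} + \<epsilon> / 2"
      by (rule exists_outer_continuity_level[OF sets cont, of "c / 2" "\<epsilon> / 2"])
         (use c e near finite_away[of "c / 2" "{z. infdist z (U k) \<le> c / 2}"] in auto)
    have "{z. infdist z (U k) \<le> 0} = U k"
      using in_closed_iff_infdist_zero[of "U k"] False infdist_nonneg[of _ "U k"]
      by (auto simp: U_def intro: antisym)
    with r k have m: "measure \<mu> {z. infdist z (U k) \<le> r} \<le> measure \<mu> E + \<epsilon>"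
      by simp
    have "closed {z. infdist z (U k) \<le> r}"
      by (intro closed_Collect_le continuous_intros)
    moreover have "\<forall>\<^sub>F n in sequentially. T n -` E \<subseteq> {z. infdist z (U k) \<le> r}"
      using ev by eventually_elim (use r in auto)
    ultimately show ?thesis
      using r c near m
      by (intro that[of "{z. infdist z (U k) \<le> r}" "c / 2"]) auto
  qed
qed

text \<open>Dual to the outer case: half of \<open>\<epsilon>\<close> is spent on replacing
  \<open>E\<close> by an open \<open>L k\<close>, half on keeping only the points at distance at
  least \<open>r\<close> from its complement. The result stays inside the preimages, so the bound
  \<open>c\<close> itself is retained.\<close>

lemma exists_inner_continuity_set:
  assumes e: "\<epsilon> > 0"
  obtains V where "V \<in> sets borel" "\<And>z. z \<in> V \<Longrightarrow> c \<le> norm z"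
    "emeasure \<mu> (frontier V) = 0" "\<forall>\<^sub>F n in sequentially. V \<subseteq> T n -` E"
    "measure \<mu> E \<le> measure \<mu> V + \<epsilon>"
proof -
  define L where "L k = interior (\<Inter>n\<in>{k..}. T n -` E)" for k
  have LE: "L k \<subseteq> T n -` E" if "k \<le> n" for k n
    using that interior_subset unfolding L_def by fastforce
  have L: "c \<le> norm z" if "z \<in> L k" for k z
    using LE[of k k] that T_vimage_norm_ge by auto
  have UnL: "emeasure \<mu> (\<Union>k. L k) < \<infinity>"
    using finite_away[OF c(1), of "\<Union>k. L k"] L by auto
  have L_sets: "L k \<in> sets \<mu>" for k
    unfolding sets L_def by (rule borel_open[OF open_interior])
  have "(\<lambda>k. measure \<mu> (L k)) \<longlonglongrightarrow> measure \<mu> (\<Union>k. L k)"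
  proof (rule Lim_measure_incseq)
    show "range L \<subseteq> sets \<mu>" using L_sets by blast
    show "incseq L" unfolding L_def by (intro incseq_SucI interior_mono INT_anti_mono) auto
    show "emeasure \<mu> (\<Union>k. L k) \<noteq> \<infinity>" using UnL by auto
  qed
  moreover have "measure \<mu> (interior E) \<le> measure \<mu> (\<Union>k. L k)"
  proof (rule measure_mono_fmeasurable)
    show "interior E \<subseteq> (\<Union>k. L k)"
      unfolding L_def by (rule interior_subset_Union_interior_vimage[OF nonexp T_lim])
    show "interior E \<in> sets \<mu>" using sets by auto
    show "(\<Union>k. L k) \<in> fmeasurable \<mu>"
      using UnL L_sets by (intro fmeasurableI sets.countable_UN) auto
  qed
  ultimately have "\<forall>\<^sub>F k in sequentially. measure \<mu> E - \<epsilon> / 2 < measure \<mu> (L k)"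
    using e by (intro order_tendstoD(1)) (auto simp: measure_closure_interior_eq)
  then obtain k where k: "measure \<mu> E - \<epsilon> / 2 < measure \<mu> (L k)"
    by (meson eventually_happens sequentially_bot)
  \<comment> \<open>The origin is a point outside \<open>L k\<close>, so the complement is nonempty
    and the distance to it is positive exactly on the open set \<open>L k\<close>.\<close>
  have "0 \<in> - L k"
    using L[of 0 k] c(1) by auto
  then have ne: "- L k \<noteq> {}" by blast
  have pos: "{z. 0 < infdist z (- L k)} = L k"
    using in_closed_iff_infdist_zero[of "- L k"] ne infdist_nonneg[of _ "- L k"]
    by (auto simp: L_def less_le)
  have cont: "continuous_on UNIV (\<lambda>z. infdist z (- L k))"
    by (intro continuous_intros)
  obtain r where r: "0 < r" "emeasure \<mu> (frontier {z. r \<le> infdist z (- L k)}) = 0"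
    "measure \<mu> {z. 0 < infdist z (- L k)} < measure \<mu> {z. r \<le> infdist z (- L k)} + \<epsilon> / 2"
    by (rule exists_inner_continuity_level[OF sets cont, of "\<epsilon> / 2"])
       (use e finite_away[OF c(1), of "L k"] L in \<open>auto simp: pos\<close>)
  have "{z. r \<le> infdist z (- L k)} \<subseteq> {z. 0 < infdist z (- L k)}"
    using r(1) by auto
  then have sub: "{z. r \<le> infdist z (- L k)} \<subseteq> L k"
    unfolding pos .
  have "closed {z. r \<le> infdist z (- L k)}"
    by (intro closed_Collect_le continuous_intros)
  moreover have "\<forall>\<^sub>F n in sequentially. {z. r \<le> infdist z (- L k)} \<subseteq> T n -` E"
    using eventually_ge_at_top[of k] by eventually_elim (use sub LE in blast)
  moreover have "c \<le> norm z" if "z \<in> {z. r \<le> infdist z (- L k)}" for z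
    using that sub L by blast
  ultimately show thesis
    using r k unfolding pos by (intro that[of "{z. r \<le> infdist z (- L k)}"]) auto
qed

end


section \<open>Interpolation\<close>

lemma grid_mesh:
  assumes "1 \<le> j" "j \<le> m + 1"
  shows "grid_ext s m j - grid_ext s m (j - 1) \<le> mesh s m"
  unfolding mesh_def using assms by (intro Max_ge) auto

text \<open>Brings the three branches of the interpolation into one form; beyond the outermost grid
  points both nodes coincide. The nodes and the weight depend on \<open>t\<close> but not on
  \<open>z\<close>, so two functions can be compared with the same combination.\<close>

lemma interpolate_convex_combination:
  assumes g: "is_grid s m"
  obtains p q l where "dist p t \<le> mesh s m" "dist q t \<le> mesh s m" "0 \<le> l" "l \<le> 1"
    "\<And>z. interpolate s m z t = (1 - l) * z p + l * z q"
proof -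
  have m: "1 \<le> m" using g by (simp add: is_grid_def)
  have t01: "0 \<le> to_real t" "to_real t \<le> 1" using to_real[of t] by auto
  consider "to_real t \<le> to_real (s 1)" | "to_real t > to_real (s m)" "to_real t > to_real (s 1)"
    | "to_real (s 1) < to_real t" "to_real t \<le> to_real (s m)" by linarith
  then show thesis
  proof cases
    case 1
    \<comment> \<open>The mesh includes the gap from the added endpoint 0 to \<open>s 1\<close>, and
      \<open>t\<close> lies in it. The gap from \<open>s m\<close> to 1 plays the same role in the
      next case.\<close>
    have "dist (s 1) t \<le> mesh s m"
      using grid_mesh[of 1 m s] m 1 t01
      by (simp add: grid_ext_def dist_to_real[symmetric] dist_real_def)
    then show ?thesis
      using 1 by (intro that[of "s 1" "s 1" 0]) (auto simp: interpolate_def)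
  next
    case 2
    have "dist (s m) t \<le> mesh s m"
      using grid_mesh[of "m + 1" m s] m 2 t01
      by (simp add: grid_ext_def dist_to_real[symmetric] dist_real_def)
    then show ?thesis
      using 2 by (intro that[of "s m" "s m" 0]) (auto simp: interpolate_def)
  next
    case 3
    \<comment> \<open>The first grid point at or after \<open>t\<close>; minimality places its
      predecessor strictly before \<open>t\<close>, which is the half-open cell used in the
      definition of \<open>interpolate\<close>.\<close>
    define i where "i = (LEAST i. 1 \<le> i \<and> to_real t \<le> to_real (s i))"
    have i: "1 \<le> i" "to_real t \<le> to_real (s i)"
      unfolding i_def using LeastI[of "\<lambda>i. 1 \<le> i \<and> to_real t \<le> to_real (s i)" m] m 3 by auto
    have im: "i \<le> m" unfolding i_def using m 3 by (intro Least_le) auto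
    have i2: "2 \<le> i" using i 3 by (metis One_nat_def Suc_1 Suc_leI le_neq_implies_less not_le)
    have ti: "to_real (s (i - 1)) < to_real t"
      using not_less_Least[of "i - 1" "\<lambda>i. 1 \<le> i \<and> to_real t \<le> to_real (s i)"] i2
      unfolding i_def[symmetric] by auto
    have gap: "to_real (s i) - to_real (s (i - 1)) \<le> mesh s m"
      using grid_mesh[of i m s] i2 im by (simp add: grid_ext_def split: if_splits)
    define l where "l = (to_real t - to_real (s (i - 1))) / (to_real (s i) - to_real (s (i - 1)))"
    have l: "1 - l = (to_real (s i) - to_real t) / (to_real (s i) - to_real (s (i - 1)))"
      using ti i by (simp add: l_def field_simps)
    show ?thesis
    proof (rule that[of "s (i - 1)" "s i" l])
      show "dist (s (i - 1)) t \<le> mesh s m" "dist (s i) t \<le> mesh s m"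
        using gap ti i by (auto simp: dist_to_real[symmetric] dist_real_def)
      show "0 \<le> l" "l \<le> 1" using ti i by (auto simp: l_def)
      show "interpolate s m z t = (1 - l) * z (s (i - 1)) + l * z (s i)" for z
        using interpolate_middle[OF g i2 im ti i(2), of z] unfolding l by (simp add: l_def)
    qed
  qed
qed

lemma convex_combination_abs_le:
  fixes x y :: real
  assumes "\<bar>x\<bar> \<le> B" "\<bar>y\<bar> \<le> B" "0 \<le> l" "l \<le> 1"
  shows "\<bar>(1 - l) * x + l * y\<bar> \<le> B"
proof -
  have "\<bar>(1 - l) * x + l * y\<bar> \<le> (1 - l) * \<bar>x\<bar> + l * \<bar>y\<bar>"
    using abs_triangle_ineq[of "(1 - l) * x" "l * y"] assms by (simp add: abs_mult)
  also have "\<dots> \<le> B"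
    using assms by (intro convex_bound_le) auto
  finally show ?thesis .
qed

text \<open>The difference of two interpolations at \<open>t\<close> is a convex combination of the
  differences of the functions at two nodes, each bounded by the sup-distance.\<close>

lemma interpolate_C01_nonexpansive:
  assumes g: "is_grid s m"
  shows "dist (interpolate_C01 s m z) (interpolate_C01 s m w) \<le> dist z w"
proof (rule dist_bound)
  fix t
  obtain p q l where "0 \<le> l" "l \<le> 1"
    and eq: "\<And>z. interpolate s m z t = (1 - l) * z p + l * z q"
    by (rule interpolate_convex_combination[OF g, where t = t]) (rule that)
  then have "\<bar>(1 - l) * (z p - w p) + l * (z q - w q)\<bar> \<le> dist z w"
    by (intro convex_combination_abs_le)
       (use dist_bounded[of z _ w] in \<open>auto simp: dist_real_def\<close>)
  then show "dist (interpolate_C01 s m z t) (interpolate_C01 s m w t) \<le> dist z w"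
    by (simp add: apply_interpolate_C01[OF g] eq dist_real_def algebra_simps)
qed

lemma interpolate_C01_0:
  assumes g: "is_grid s m"
  shows "interpolate_C01 s m 0 = 0"
proof (rule bcontfun_eqI)
  fix t
  obtain p q l where "\<And>z. interpolate s m z t = (1 - l) * z p + l * z q"
    by (rule interpolate_convex_combination[OF g, where t = t]) (rule that)
  then show "interpolate_C01 s m 0 t = (0 :: C01) t"
    by (simp add: apply_interpolate_C01[OF g])
qed

text \<open>Paths are uniformly continuous by compactness. Once the mesh is small, the interpolated
  value averages two values of \<open>z\<close> taken close to \<open>t\<close>, uniformly in
  \<open>t\<close>.\<close>

lemma interpolate_C01_tendsto:
  assumes g: "\<And>n. n \<ge> 1 \<Longrightarrow> is_grid (s n) (m n)" and mesh: "(\<lambda>n. mesh (s n) (m n)) \<longlonglongrightarrow> 0"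
  shows "(\<lambda>n. interpolate_C01 (s n) (m n) z) \<longlonglongrightarrow> z"
proof (rule tendstoI)
  fix e :: real assume "e > 0"
  have "uniformly_continuous_on UNIV (apply_bcontfun z)"
    by (intro compact_uniformly_continuous compact_UNIV_unit_interval
          continuous_on_apply_bcontfun)
  then obtain d where d: "d > 0" "\<And>x y. dist x y < d \<Longrightarrow> dist (z x) (z y) < e / 2"
    using \<open>e > 0\<close> unfolding uniformly_continuous_on_def by (force dest: spec[of _ "e / 2"])
  have "\<forall>\<^sub>F n in sequentially. mesh (s n) (m n) < d"
    using mesh d(1) by (rule order_tendstoD)
  with eventually_ge_at_top[of 1]
  show "\<forall>\<^sub>F n in sequentially. dist (interpolate_C01 (s n) (m n) z) z < e"
  proof eventually_elim
    case (elim n)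
    \<comment> \<open>Bounds at all times \<open>t\<close> give only a weak inequality for the
      sup-distance, hence the margin \<open>e / 2\<close>.\<close>
    have "dist (interpolate_C01 (s n) (m n) z) z \<le> e / 2"
    proof (rule dist_bound)
      fix t
      obtain p q l where pq: "dist p t < d" "dist q t < d" "0 \<le> l" "l \<le> 1"
        and eq: "\<And>z. interpolate (s n) (m n) z t = (1 - l) * z p + l * z q"
        by (rule interpolate_convex_combination[OF g[OF elim(1)], where t = t])
           (rule that, use elim(2) in auto)
      have "\<bar>(1 - l) * (z p - z t) + l * (z q - z t)\<bar> \<le> e / 2"
        using pq d(2)[of p t] d(2)[of q t]
        by (intro convex_combination_abs_le) (auto simp: dist_real_def)
      then show "dist (interpolate_C01 (s n) (m n) z t) (z t) \<le> e / 2"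
        by (simp add: apply_interpolate_C01[OF g[OF elim(1)]] eq dist_real_def algebra_simps)
    qed
    with \<open>e > 0\<close> show ?case by linarith
  qed
qed


section \<open>Convergence of the interpolated measures\<close>

text \<open>Density of the reals yields a real \<open>c\<close> even when the infimum is
  \<infinity>, as it is for the empty set.\<close>

lemma bounded_away_from_0_iff:
  "bounded_away_from_0 E \<longleftrightarrow> (\<exists>c>0. \<forall>z\<in>E. c \<le> norm z)"
proof
  assume "bounded_away_from_0 E"
  then obtain c where "0 < c" "ereal c < (INF z\<in>E. ereal (norm z))"
    unfolding bounded_away_from_0_def by (auto dest: ereal_dense2)
  then have "\<forall>z\<in>E. c \<le> norm z"
    by (auto dest: less_INF_D intro: less_imp_le)
  with \<open>0 < c\<close> show "\<exists>c>0. \<forall>z\<in>E. c \<le> norm z" by auto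
next
  assume "\<exists>c>0. \<forall>z\<in>E. c \<le> norm z"
  then obtain c where "c > 0" "\<forall>z\<in>E. c \<le> norm z" by auto
  then have "ereal c \<le> (INF z\<in>E. ereal (norm z))"
    by (intro INF_greatest) auto
  with \<open>c > 0\<close> show "bounded_away_from_0 E"
    unfolding bounded_away_from_0_def by (metis ereal_less(2) order_less_le_trans)
qed

section \<open>A sandwich principle for convergence in probability\<close>

lemma abs_diff_le_sandwich:
  fixes A S B :: ennreal and a b c \<epsilon> :: real
  assumes "A \<le> S" "S \<le> B" "0 \<le> a" "0 \<le> b" "0 \<le> c" "0 < \<epsilon>"
    and a: "\<bar>enn2ereal A - enn2ereal (ennreal a)\<bar> \<le> ereal (\<epsilon> / 2)"
    and b: "\<bar>enn2ereal B - enn2ereal (ennreal b)\<bar> \<le> ereal (\<epsilon> / 2)"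
    and "c \<le> a + \<epsilon> / 2" "b \<le> c + \<epsilon> / 2"
  shows "\<bar>enn2ereal S - enn2ereal (ennreal c)\<bar> \<le> ereal \<epsilon>"
proof -
  \<comment> \<open>An infinite \<open>B\<close> would be infinitely far from the real
    \<open>b\<close>. So \<open>B\<close> is finite, and with it \<open>S\<close> and
    \<open>A\<close>; the rest is real arithmetic.\<close>
  obtain B' where B': "0 \<le> B'" "B = ennreal B'"
    using b \<open>0 \<le> b\<close> by (cases B) (auto simp: enn2ereal_ennreal)
  obtain S' where S': "0 \<le> S'" "S = ennreal S'"
    using \<open>S \<le> B\<close> B' by (cases S) (auto simp: top_unique)
  obtain A' where A': "0 \<le> A'" "A = ennreal A'"
    using \<open>A \<le> S\<close> S' by (cases A) (auto simp: top_unique)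
  have "A' \<le> S'" "S' \<le> B'"
    using assms(1,2) A' S' B' by auto
  moreover have "\<bar>A' - a\<bar> \<le> \<epsilon> / 2" "\<bar>B' - b\<bar> \<le> \<epsilon> / 2"
    using a b A' B' assms(3,4) by (auto simp: enn2ereal_ennreal)
  ultimately have "\<bar>S' - c\<bar> \<le> \<epsilon>"
    using assms by linarith
  then show ?thesis
    using S' \<open>0 \<le> c\<close> by (simp add: enn2ereal_ennreal)
qed

text \<open>If \<open>S\<close> is off by more than \<open>\<epsilon>\<close>, then one of the
  bounds is off its own limit by more than \<open>\<epsilon> / 2\<close>, so the probabilities add.
  The bounds may change with \<open>\<epsilon>\<close>, and their limits need only be near
  \<open>c\<close>.\<close>

lemma converges_in_probability_sandwich:
  fixes c :: real
  assumes "finite_measure M" "0 \<le> c"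
    and approx: "\<And>\<epsilon>. \<epsilon> > 0 \<Longrightarrow> \<exists>A B a b. 0 \<le> a \<and> 0 \<le> b \<and> c \<le> a + \<epsilon> \<and> b \<le> c + \<epsilon> \<and>
      converges_in_probability M A (ennreal a) \<and> converges_in_probability M B (ennreal b) \<and>
      (\<forall>\<^sub>F n in sequentially. A n \<in> borel_measurable M \<and> B n \<in> borel_measurable M \<and>
        (\<forall>\<omega>\<in>space M. A n \<omega> \<le> S n \<omega> \<and> S n \<omega> \<le> B n \<omega>))"
  shows "converges_in_probability M S (ennreal c)"
  unfolding converges_in_probability_def
proof (intro allI impI)
  interpret finite_measure M by fact
  fix \<epsilon> :: real assume e: "\<epsilon> > 0"
  obtain A B a b where ab: "0 \<le> a" "0 \<le> b" "c \<le> a + \<epsilon> / 2" "b \<le> c + \<epsilon> / 2"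
    and A: "converges_in_probability M A (ennreal a)"
    and B: "converges_in_probability M B (ennreal b)"
    and ev: "\<forall>\<^sub>F n in sequentially. A n \<in> borel_measurable M \<and> B n \<in> borel_measurable M \<and>
        (\<forall>\<omega>\<in>space M. A n \<omega> \<le> S n \<omega> \<and> S n \<omega> \<le> B n \<omega>)"
    using approx[OF half_gt_zero[OF e]] by blast
  define P where "P S c \<epsilon> n = {\<omega>\<in>space M. \<bar>enn2ereal (S n \<omega>) - enn2ereal (ennreal c)\<bar> > ereal \<epsilon>}"
    for S :: "nat \<Rightarrow> _ \<Rightarrow> ennreal" and c \<epsilon> n
  have "(\<lambda>n. measure M (P A a (\<epsilon> / 2) n) + measure M (P B b (\<epsilon> / 2) n)) \<longlonglongrightarrow> 0"
    using A B e unfolding converges_in_probability_def P_def by (intro tendsto_add_zero) auto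
  moreover have "\<forall>\<^sub>F n in sequentially. norm (measure M (P S c \<epsilon> n)) \<le>
      measure M (P A a (\<epsilon> / 2) n) + measure M (P B b (\<epsilon> / 2) n)"
    using ev
  proof eventually_elim
    case (elim n)
    have meas: "A n \<in> borel_measurable M" "B n \<in> borel_measurable M" using elim by auto
    have [measurable]: "P A a (\<epsilon> / 2) n \<in> sets M" "P B b (\<epsilon> / 2) n \<in> sets M"
      using meas unfolding P_def by measurable
    have "P S c \<epsilon> n \<subseteq> P A a (\<epsilon> / 2) n \<union> P B b (\<epsilon> / 2) n"
    proof (rule subsetI, rule ccontr)
      fix \<omega> assume "\<omega> \<in> P S c \<epsilon> n" "\<omega> \<notin> P A a (\<epsilon> / 2) n \<union> P B b (\<epsilon> / 2) n"
      then show False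
        using abs_diff_le_sandwich[of "A n \<omega>" "S n \<omega>" "B n \<omega>" a b c \<epsilon>] elim ab e \<open>0 \<le> c\<close>
        unfolding P_def by (auto simp: not_less)
    qed
    then have "measure M (P S c \<epsilon> n) \<le> measure M (P A a (\<epsilon> / 2) n \<union> P B b (\<epsilon> / 2) n)"
      by (intro finite_measure_mono) auto
    also have "\<dots> \<le> measure M (P A a (\<epsilon> / 2) n) + measure M (P B b (\<epsilon> / 2) n)"
      by (intro measure_Un_le) auto
    finally show ?case by simp
  qed
  ultimately have "(\<lambda>n. measure M (P S c \<epsilon> n)) \<longlonglongrightarrow> 0"
    by (rule Lim_null_comparison[rotated])
  then show "(\<lambda>n. measure M {\<omega>\<in>space M. ereal \<epsilon> < \<bar>enn2ereal (S n \<omega>) - enn2ereal (ennreal c)\<bar>}) \<longlonglongrightarrow> 0"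
    unfolding P_def .
qed

theorem theorem2p6:
  fixes M :: "'w measure" and N :: "'v measure"
    and X \<xi> :: "nat \<Rightarrow> 'w \<Rightarrow> C01"
    and a b :: "nat \<Rightarrow> unit_interval \<Rightarrow> real"
    and \<gamma> :: "unit_interval \<Rightarrow> real"
    and Y Z :: "'v \<Rightarrow> C01"
    and \<nu> :: "C01 measure"
    and \<nu>_hat :: "nat \<Rightarrow> 'w \<Rightarrow> C01 measure"
    and grid :: "nat \<Rightarrow> nat \<Rightarrow> unit_interval" and k :: "nat \<Rightarrow> nat"
  assumes prob_M: "prob_space M" and prob_N: "prob_space N"
    and X_indep: "prob_space.indep_vars M (\<lambda>_. borel) X {1..}"
    and X_ident: "\<And>i. i \<ge> 1 \<Longrightarrow> distr M borel (X i) = distr M borel (X 1)"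
    and a_pos: "\<And>n t. n \<ge> 1 \<Longrightarrow> a n t > 0"
    and max_X_conv: "converges_weakly_C01 M
      (\<lambda>n \<omega> t. MAX i\<in>{1..n}. (X i \<omega> t - b n t) / a n t) N Y"
    and Y_max_stable: "max_stable N Y"
    and \<gamma>_cont: "continuous_on UNIV \<gamma>"
    and Y_margins: "\<And>t y. 1 + \<gamma> t * y > 0 \<Longrightarrow> marginal_cdf N Y t y = gev_cdf (\<gamma> t) y"
    and \<xi>_def: "\<And>i. i \<ge> 1 \<Longrightarrow>
      C01_version M (\<lambda>\<omega> t. 1 / (1 - marginal_cdf M (X 1) t (X i \<omega> t))) (\<xi> i)"
    and Z_def: "C01_version N (\<lambda>\<omega> t. gev_to_frechet (\<gamma> t) (Y \<omega> t)) Z"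
    and max_\<xi>_conv: "converges_weakly_C01 M
      (\<lambda>n \<omega> t. 1 / real n * (MAX i\<in>{1..n}. \<xi> i \<omega> t)) N Z"
    and \<nu>_exponent: "exponent_measure N Z \<nu>"
    and \<nu>_limit: "\<And>E. E \<in> sets borel \<Longrightarrow> bounded_away_from_0 E \<Longrightarrow> emeasure \<nu> (frontier E) = 0 \<Longrightarrow>
      ((\<lambda>u::real. u * measure M {\<omega>\<in>space M. (1 / u) *\<^sub>R \<xi> 1 \<omega> \<in> E}) \<longlongrightarrow> measure \<nu> E) at_top"
    and is_grid: "\<And>n. n \<ge> 1 \<Longrightarrow> is_grid (grid n) (k n)"
    and mesh_0: "(\<lambda>n. mesh (grid n) (k n)) \<longlonglongrightarrow> 0"
    and \<nu>_hat_random: "\<And>n. n \<ge> 1 \<Longrightarrow> random_measure_C01 M (\<nu>_hat n)"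
    and \<nu>_hat_conv: "\<And>E. E \<in> sets borel \<Longrightarrow> bounded_away_from_0 E \<Longrightarrow>
      emeasure \<nu> (frontier E) = 0 \<Longrightarrow>
      converges_in_probability M (\<lambda>n \<omega>. emeasure (\<nu>_hat n \<omega>) E) (emeasure \<nu> E)"
  shows "\<And>E. E \<in> sets borel \<Longrightarrow> bounded_away_from_0 E \<Longrightarrow>
      emeasure \<nu> (frontier E) = 0 \<Longrightarrow>
      converges_in_probability M
        (\<lambda>n \<omega>. emeasure (\<nu>_hat n \<omega>) {z. interpolate_C01 (grid n) (k n) z \<in> E}) (emeasure \<nu> E)"
proof -
  fix E :: "C01 set"
  assume E: "E \<in> sets borel" "bounded_away_from_0 E" "emeasure \<nu> (frontier E) = 0"
  \<comment> \<open>Grids are assumed only from index 1 on, whereas the trapping lemmas speak of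
    every \<open>n\<close>; the identity fills index 0.\<close>
  define T where "T n = (if n = 0 then id else interpolate_C01 (grid n) (k n))" for n
  have T_eq: "T n = interpolate_C01 (grid n) (k n)" if "n \<ge> 1" for n
    using that by (simp add: T_def)
  have nonexp: "dist (T n x) (T n y) \<le> dist x y" for n x y
    using interpolate_C01_nonexpansive[OF is_grid] by (simp add: T_def)
  have T_0: "T n 0 = 0" for n
    using interpolate_C01_0[OF is_grid] by (simp add: T_def)
  have T_lim: "(\<lambda>n. T n z) \<longlonglongrightarrow> z" for z
    using interpolate_C01_tendsto[OF is_grid mesh_0, of z]
    by (rule Lim_transform_eventually)
       (auto intro!: eventually_mono[OF eventually_ge_at_top[of 1]] simp: T_eq)
  \<comment> \<open>Nonexpansive maps are continuous, so preimages of Borel sets are Borel. This is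
    what permits monotonicity of the random measures below.\<close>
  have T_meas: "T n -` E \<in> sets borel" for n
  proof -
    have "continuous_on UNIV (T n)"
      unfolding continuous_on_iff using nonexp by (meson le_less_trans)
    then show ?thesis
      using measurable_sets_borel[OF borel_measurable_continuous_onI E(1)] by auto
  qed
  have sets: "sets \<nu> = sets borel"
    and away_fin: "\<And>A. A \<in> sets borel \<Longrightarrow> bounded_away_from_0 A \<Longrightarrow> emeasure \<nu> A < \<infinity>"
    using \<nu>_exponent by (auto simp: exponent_measure_def)
  have fin: "emeasure \<nu> {z. d \<le> norm z} < \<infinity>" if "d > 0" for d
  proof (rule away_fin)
    have "closed {z::C01. d \<le> norm z}" by (intro closed_Collect_le continuous_intros)
    then show "{z::C01. d \<le> norm z} \<in> sets borel" by simp
  qed (use that in \<open>auto simp: bounded_away_from_0_iff\<close>)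
  obtain c where c: "c > 0" "\<And>z. z \<in> E \<Longrightarrow> c \<le> norm z"
    using E(2) by (auto simp: bounded_away_from_0_iff)
  have hat_sets: "sets (\<nu>_hat n \<omega>) = sets borel" if "n \<ge> 1" "\<omega> \<in> space M" for n \<omega>
    using \<nu>_hat_random[OF that(1)] that(2) by (auto simp: random_measure_C01_def)
  have hat_meas: "(\<lambda>\<omega>. emeasure (\<nu>_hat n \<omega>) V) \<in> borel_measurable M"
    if "n \<ge> 1" "V \<in> sets borel" for n V
    using \<nu>_hat_random[OF that(1)] that(2) by (auto simp: random_measure_C01_def)
  \<comment> \<open>The sandwich principle has real limits; sets bounded away from 0 have finite
    mass, so nothing is lost in passing to \<open>measure\<close>.\<close>
  have real_eq: "emeasure \<nu> V = ennreal (measure \<nu> V)"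
    if "V \<in> sets borel" "bounded_away_from_0 V" for V
    using away_fin[OF that] by (simp add: emeasure_eq_ennreal_measure)
  have "converges_in_probability M
    (\<lambda>n \<omega>. emeasure (\<nu>_hat n \<omega>) {z. interpolate_C01 (grid n) (k n) z \<in> E}) (ennreal (measure \<nu> E))"
  proof (rule converges_in_probability_sandwich)
    show "finite_measure M" using prob_M by (simp add: prob_space_def)
    fix \<epsilon> :: real assume e: "\<epsilon> > 0"
    \<comment> \<open>\<open>V\<close> and the inner set \<open>W\<close> do not depend on
      \<open>n\<close>, so the assumed convergence applies to them, which it would not to preimages
      varying with \<open>n\<close>.\<close>
    obtain V d where V: "V \<in> sets borel" "d > 0" "\<And>z. z \<in> V \<Longrightarrow> d \<le> norm z"
      "emeasure \<nu> (frontier V) = 0" "\<forall>\<^sub>F n in sequentially. T n -` E \<subseteq> V"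
      "measure \<nu> V \<le> measure \<nu> E + \<epsilon>"
      using exists_outer_continuity_set[OF nonexp T_lim T_0 sets fin E(1,3) c e] by metis
    obtain W where W: "W \<in> sets borel" "\<And>z. z \<in> W \<Longrightarrow> c \<le> norm z"
      "emeasure \<nu> (frontier W) = 0" "\<forall>\<^sub>F n in sequentially. W \<subseteq> T n -` E"
      "measure \<nu> E \<le> measure \<nu> W + \<epsilon>"
      using exists_inner_continuity_set[OF nonexp T_lim T_0 sets fin E(1,3) c e] by metis
    have away: "bounded_away_from_0 V" "bounded_away_from_0 W"
      using V W c by (auto simp: bounded_away_from_0_iff)
    let ?hat = "\<lambda>V n \<omega>. emeasure (\<nu>_hat n \<omega>) V"
    have "\<forall>\<^sub>F n in sequentially. ?hat W n \<in> borel_measurable M \<and> ?hat V n \<in> borel_measurable M \<and>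
        (\<forall>\<omega>\<in>space M. ?hat W n \<omega> \<le> ?hat {z. interpolate_C01 (grid n) (k n) z \<in> E} n \<omega> \<and>
          ?hat {z. interpolate_C01 (grid n) (k n) z \<in> E} n \<omega> \<le> ?hat V n \<omega>)"
      using V(5) W(4) eventually_ge_at_top[of 1]
    proof eventually_elim
      case (elim n)
      have eq: "{z. interpolate_C01 (grid n) (k n) z \<in> E} = T n -` E"
        using T_eq[OF elim(3)] by auto
      show ?case
        unfolding eq using elim V(1) W(1) T_meas hat_meas hat_sets
        by (auto intro!: emeasure_mono)
    qed
    moreover have "converges_in_probability M (?hat W) (ennreal (measure \<nu> W))"
      using \<nu>_hat_conv[OF W(1) away(2) W(3)] by (simp add: real_eq[OF W(1) away(2)])
    moreover have "converges_in_probability M (?hat V) (ennreal (measure \<nu> V))"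
      using \<nu>_hat_conv[OF V(1) away(1) V(4)] by (simp add: real_eq[OF V(1) away(1)])
    ultimately show "\<exists>A B a b. 0 \<le> a \<and> 0 \<le> b \<and> measure \<nu> E \<le> a + \<epsilon> \<and> b \<le> measure \<nu> E + \<epsilon> \<and>
      converges_in_probability M A (ennreal a) \<and> converges_in_probability M B (ennreal b) \<and>
      (\<forall>\<^sub>F n in sequentially. A n \<in> borel_measurable M \<and> B n \<in> borel_measurable M \<and>
        (\<forall>\<omega>\<in>space M. A n \<omega> \<le> ?hat {z. interpolate_C01 (grid n) (k n) z \<in> E} n \<omega> \<and>
          ?hat {z. interpolate_C01 (grid n) (k n) z \<in> E} n \<omega> \<le> B n \<omega>))"
      using V(6) W(5) measure_nonneg by blast
  qed simp
  then show "converges_in_probability M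
    (\<lambda>n \<omega>. emeasure (\<nu>_hat n \<omega>) {z. interpolate_C01 (grid n) (k n) z \<in> E}) (emeasure \<nu> E)"
    by (simp add: real_eq[OF E(1,2)])
qed

end
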